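(* Let $\mathbf{a}=(a_1,\ldots,a_n,\ldots)$ be a non-increasing sequence of positive real numbers such that $\sum_{n=1}^\infty a_n=1$. Then each real number $r$ with $0\le r\le 1$ can be represented in the form $$r=\sum_{n=1}^\infty \varepsilon_n a_n,\qquad \varepsilon_n\in\{0,1\},\ n\ge 1,$$ if and only if $$a_n\le 1-\sum_{k=1}^n a_k\quad\text{for all } n\ge 1.$$
   Context: Positive means strictly positive. *)

theory Defs
  imports Complex_Main
begin

end

theory Submission
  imports Defs
begin

text \<open>
  If every term is at most the tail following it, the greedy expansion of \<open>r\<close> keeps the
  remainder between \<open>0\<close> and the current tail, so it converges to \<open>r\<close>. Conversely, if some
  term exceeds the tail following it, no number strictly between the two is a subsum: using that
  term or an earlier one overshoots, and using only later terms falls short.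
\<close>

text \<open>Recording the partial sums instead of the digits makes both bounds on the remainder
  plain inductions; the digits are read off afterwards.\<close>

fun greedy_sum :: "(nat \<Rightarrow> real) \<Rightarrow> real \<Rightarrow> nat \<Rightarrow> real" where
  "greedy_sum b r 0 = 0"
| "greedy_sum b r (Suc n) =
     (if greedy_sum b r n + b n \<le> r then greedy_sum b r n + b n else greedy_sum b r n)"

lemma greedy_sum_le:
  assumes "0 \<le> r"
  shows "greedy_sum b r n \<le> r"
  using assms by (induction n) auto

text \<open>Taking \<open>b n\<close> lowers the remainder and the tail by the same amount. Skipping
  it means that the remainder is below \<open>b n\<close>, which is at most the next tail by
  assumption.\<close>

lemma greedy_remainder_le_tail:
  assumes "r \<le> S" and "\<And>n. b n \<le> S - (\<Sum>k\<le>n. b k)"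
  shows "r - greedy_sum b r n \<le> S - (\<Sum>k<n. b k)"
proof (induction n)
  case 0
  then show ?case using assms(1) by simp
next
  case (Suc n)
  then show ?case
    using assms(2)[of n] by (auto simp: lessThan_Suc_atMost[symmetric])
qed

lemma subsum_exists:
  fixes b :: "nat \<Rightarrow> real"
  assumes "b sums S" and "\<And>n. b n \<le> S - (\<Sum>k\<le>n. b k)" and "0 \<le> r" and "r \<le> S"
  shows "\<exists>e::nat \<Rightarrow> real. (\<forall>n. e n \<in> {0, 1}) \<and> (\<lambda>n. e n * b n) sums r"
proof -
  define e :: "nat \<Rightarrow> real" where "e n = (if greedy_sum b r n + b n \<le> r then 1 else 0)" for n
  have partial: "(\<Sum>k<n. e k * b k) = greedy_sum b r n" for n
    by (induction n) (auto simp: e_def)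
  \<comment> \<open>Lower half of the squeeze: the remainder is at most the tail, and the tail of a
    convergent series tends to 0.\<close>
  have lower: "(\<lambda>n. r - (S - (\<Sum>k<n. b k))) \<longlonglongrightarrow> r - (S - S)"
    using assms(1) unfolding sums_def by (intro tendsto_intros)
  have "greedy_sum b r \<longlonglongrightarrow> r"
  proof (rule tendsto_sandwich)
    show "\<forall>\<^sub>F n in sequentially. r - (S - (\<Sum>k<n. b k)) \<le> greedy_sum b r n"
      using greedy_remainder_le_tail[OF assms(4,2)]
      by (intro always_eventually allI) (simp add: algebra_simps)
    show "\<forall>\<^sub>F n in sequentially. greedy_sum b r n \<le> r"
      using greedy_sum_le[OF assms(3)] by simp
  qed (use lower in auto)
  then have "(\<lambda>n. e n * b n) sums r"
    by (simp add: sums_def partial)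
  moreover have "\<forall>n. e n \<in> {0, 1}" by (simp add: e_def)
  ultimately show ?thesis by blast
qed

text \<open>By monotonicity every term up to index \<open>n\<close> is at least \<open>b n\<close>,
  hence larger than \<open>r\<close>, so a subsum equal to \<open>r\<close> uses none of
  them.\<close>

lemma subsum_gap:
  fixes b e :: "nat \<Rightarrow> real"
  assumes b: "b sums S" and nonneg: "\<And>n. 0 \<le> b n" and dec: "decseq b"
    and e: "\<And>n. e n \<in> {0, 1}" and r: "(\<lambda>n. e n * b n) sums r" and "r < b n"
  shows "r \<le> S - (\<Sum>k\<le>n. b k)"
proof -
  have term_nonneg: "0 \<le> e k * b k" for k
    using e[of k] nonneg[of k] by auto
  have e0: "e k = 0" if "k \<le> n" for k
  proof (rule ccontr)
    assume "e k \<noteq> 0"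
    \<comment> \<open>A single term is a finite partial sum of a series of nonnegative terms, so it
      is bounded by the total \<open>r\<close>.\<close>
    then have "b k = (\<Sum>i\<in>{k}. e i * b i)" using e[of k] by simp
    also have "\<dots> \<le> r"
      using sum_le_suminf[OF sums_summable[OF r], of "{k}"] term_nonneg sums_unique[OF r] by auto
    finally show False using decseqD[OF dec that] \<open>r < b n\<close> by simp
  qed
  \<comment> \<open>The tail is written with its first \<open>n + 1\<close> terms zeroed rather than
    with a shifted index, so that it can be compared with the subsum term by term.\<close>
  have tail: "(\<lambda>k. b k - (if k \<in> {..n} then b k else 0)) sums (S - (\<Sum>k\<le>n. b k))"
    by (intro sums_diff b sums_If_finite_set) simp
  show ?thesis
  proof (rule sums_le[OF _ r tail])
    show "e k * b k \<le> b k - (if k \<in> {..n} then b k else 0)" for k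
      using e0[of k] e[of k] nonneg[of k] by auto
  qed
qed

lemma term_le_tail_if_all_subsums:
  fixes b :: "nat \<Rightarrow> real"
  assumes b: "b sums S" and nonneg: "\<And>n. 0 \<le> b n" and dec: "decseq b"
    and all: "\<And>r. 0 \<le> r \<Longrightarrow> r \<le> S \<Longrightarrow>
      \<exists>e::nat \<Rightarrow> real. (\<forall>n. e n \<in> {0, 1}) \<and> (\<lambda>n. e n * b n) sums r"
  shows "b n \<le> S - (\<Sum>k\<le>n. b k)"
proof (rule ccontr)
  assume gap: "\<not> ?thesis"
  have bounded: "sum b I \<le> S" if "finite I" for I
    using sum_le_suminf[OF sums_summable[OF b] that] nonneg sums_unique[OF b] by auto
  \<comment> \<open>The midpoint of the gap between the tail and \<open>b n\<close>;
    \<open>bounded\<close> places it in the interval from 0 to \<open>S\<close>.\<close>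
  define r where "r = (b n + (S - (\<Sum>k\<le>n. b k))) / 2"
  have "0 \<le> r" "r \<le> S" "r < b n" "S - (\<Sum>k\<le>n. b k) < r"
    using gap bounded[of "{..n}"] bounded[of "{n}"] nonneg[of n] by (auto simp: r_def)
  then show False
    using all[of r] subsum_gap[OF b nonneg dec, of _ r n] by force
qed

theorem theorem2p1:
  fixes a :: "nat \<Rightarrow> real"
  assumes pos: "\<And>n. 1 \<le> n \<Longrightarrow> 0 < a n"
    and noninc: "\<And>m n. 1 \<le> m \<Longrightarrow> m \<le> n \<Longrightarrow> a n \<le> a m"
    and total: "(\<lambda>n. a (Suc n)) sums 1"
  shows "(\<forall>r::real. 0 \<le> r \<and> r \<le> 1 \<longrightarrow>
            (\<exists>\<epsilon>::nat \<Rightarrow> real. (\<forall>n\<ge>1. \<epsilon> n \<in> {0, 1}) \<and>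
               (\<lambda>n. \<epsilon> (Suc n) * a (Suc n)) sums r))
         \<longleftrightarrow> (\<forall>n\<ge>1. a n \<le> 1 - (\<Sum>k=1..n. a k))"
    (is "?subsums \<longleftrightarrow> ?tails")
proof
  \<comment> \<open>The theorem counts from 1 and the lemmas from 0; this translates the partial
    sums.\<close>
  have shift: "(\<Sum>k=1..Suc n. a k) = (\<Sum>k\<le>n. a (Suc k))" for n
    using sum.shift_bounds_cl_Suc_ivl[of a 0 n] by (simp add: atMost_atLeast0)
  {
    assume subsums: ?subsums
    have "a (Suc n) \<le> 1 - (\<Sum>k\<le>n. a (Suc k))" for n
    proof (rule term_le_tail_if_all_subsums[where b = "\<lambda>n. a (Suc n)", OF total])
      show "0 \<le> a (Suc n)" for n using pos[of "Suc n"] by simp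
      show "decseq (\<lambda>n. a (Suc n))" using noninc by (simp add: decseq_def)
      fix r :: real
      assume "0 \<le> r" "r \<le> 1"
      then obtain \<epsilon> :: "nat \<Rightarrow> real" where "\<forall>n\<ge>1. \<epsilon> n \<in> {0, 1}"
        "(\<lambda>n. \<epsilon> (Suc n) * a (Suc n)) sums r"
        using subsums by blast
      then show "\<exists>e::nat \<Rightarrow> real. (\<forall>n. e n \<in> {0, 1}) \<and> (\<lambda>n. e n * a (Suc n)) sums r"
        by (intro exI[of _ "\<lambda>n. \<epsilon> (Suc n)"]) simp
    qed
    then have "a (Suc n) \<le> 1 - (\<Sum>k=1..Suc n. a k)" for n
      unfolding shift .
    then show ?tails
      by (metis One_nat_def Suc_le_D)
  next
    assume tails: ?tails
    have "a (Suc n) \<le> 1 - (\<Sum>k\<le>n. a (Suc k))" for n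
      using tails[rule_format, of "Suc n"] unfolding shift by simp
    note exists = subsum_exists[where b = "\<lambda>n. a (Suc n)", OF total this]
    show ?subsums
    proof (intro allI impI)
      fix r :: real
      assume "0 \<le> r \<and> r \<le> 1"
      then obtain e :: "nat \<Rightarrow> real" where "\<forall>n. e n \<in> {0, 1}" "(\<lambda>n. e n * a (Suc n)) sums r"
        using exists by blast
      then show "\<exists>\<epsilon>::nat \<Rightarrow> real. (\<forall>n\<ge>1. \<epsilon> n \<in> {0, 1}) \<and>
          (\<lambda>n. \<epsilon> (Suc n) * a (Suc n)) sums r"
        \<comment> \<open>The shift by one is undone: at \<open>Suc n\<close> the new digit is
          \<open>e n\<close>.\<close>
        by (intro exI[of _ "\<lambda>n. e (n - 1)"]) simp
    qed
  }
qed

end
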